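(* Let $a,b>1$ be integers. The set $S$ of four ribbon tetrominoes tiles the modified rectangle $M(a,b)$ if and only if one of the following holds: 1. $a\equiv 2 \pmod 4$ and $b$ is odd; or 2. $a$ is odd and $ab\equiv 2\pmod 8$.
   Context: Work in the integer lattice of unit squares; identify a square with the coordinates $(i,j)\in\mathbb{Z}^2$ of its lower-left corner ($i$ increases to the right, $j$ increases upward). $M(a,b)$ is the region obtained from the rectangle with $a$ rows and $b$ columns (height $a$, width $b$) by removing the upper-left and lower-right squares, i.e. $\{(i,j):0\le i<b,\ 0\le j<a\}\setminus\{(0,a-1),(b-1,0)\}$. The set $S=\{t_2,t_3,t_5,t_8\}$ consists of the following tiles (up to translation): $t_2=\{(0,0),(1,0),(2,0),(2,1)\}$, $t_3=\{(0,0),(1,0),(1,1),(2,1)\}$, $t_5=\{(0,0),(0,1),(1,1),(2,1)\}$, $t_8=\{(0,0),(0,1),(0,2),(0,3)\}$. A set of tiles tiles a region if the region can be covered, without gaps or overlaps, by lattice translates of copies of tiles in the set (rotations and reflections are not allowed; not every tile need be used). *)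

theory Defs
  imports Main "HOL-Library.Disjoint_Sets" "HOL-Number_Theory.Cong"
begin

text \<open>A unit square of the integer lattice is named by its lower-left corner \<open>(i, j)\<close>,
  with \<open>i\<close> increasing to the right and \<open>j\<close> increasing upward.\<close>

type_synonym square = "int \<times> int"

definition translate :: "int \<times> int \<Rightarrow> square set \<Rightarrow> square set" where
  "translate v A = (\<lambda>(i, j). (i + fst v, j + snd v)) ` A"

definition tiles :: "square set set \<Rightarrow> square set \<Rightarrow> bool" where
  "tiles T R \<longleftrightarrow>
     (\<exists>P. (\<forall>p\<in>P. \<exists>t\<in>T. \<exists>v. p = translate v t) \<and> disjoint P \<and> \<Union> P = R)"

text \<open>Height comes first: \<open>M a b\<close> has \<open>a\<close> rows and \<open>b\<close> columns.\<close>

definition M :: "int \<Rightarrow> int \<Rightarrow> square set" where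
  "M a b = {(i, j). 0 \<le> i \<and> i < b \<and> 0 \<le> j \<and> j < a} - {(0, a - 1), (b - 1, 0)}"

definition t2 :: "square set" where
  "t2 = {(0, 0), (1, 0), (2, 0), (2, 1)}"

definition t3 :: "square set" where
  "t3 = {(0, 0), (1, 0), (1, 1), (2, 1)}"

definition t5 :: "square set" where
  "t5 = {(0, 0), (0, 1), (1, 1), (2, 1)}"

definition t8 :: "square set" where
  "t8 = {(0, 0), (0, 1), (0, 2), (0, 3)}"

definition S :: "square set set" where
  "S = {t2, t3, t5, t8}"

end

theory Submission
  imports Defs
begin

text \<open>Record a lattice path of up- and right-steps as a word. Swapping a letter \<open>U\<close> with a letter \<open>R\<close> four
  places later makes the path sweep out a ribbon tetromino, and the four tiles are exactly the ribbons for
  which the three letters in between contain an even number of \<open>R\<close>. So a tiling of \<open>M a b\<close> amounts to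
  rewriting \<open>U\<^sup>m R U R\<^sup>n\<close> into \<open>R\<^sup>n U R U\<^sup>m\<close> by such swaps, where \<open>m = a - 1\<close> and \<open>n = b - 1\<close>.
  Tilings arise because \<open>U\<^sup>4\<close> commutes with everything, \<open>URU\<close> with \<open>R\<^sup>2\<close>, and \<open>U\<^sup>5\<close> and \<open>UURU\<close>
  with \<open>R\<^sup>8\<close>. Conversely, the positions of the letters \<open>R\<close> behave like beads on a four-runner abacus: a
  swap moves one bead by four places past an even number of others, so the parity of the number of pairs
  of beads that are inverted modulo four does not change. Comparing the two words gives, besides the
  area condition \<open>4 dvd a * b - 2\<close>, the condition modulo eight.\<close>

section \<open>Frontiers\<close>

datatype letter = U | R

text \<open>The path with step word \<open>w\<close> starts at the origin; the squares on the diagonal \<open>i + j = s\<close> to its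
  upper left are those with \<open>i < rank w s\<close>.\<close>

primrec rank :: "letter list \<Rightarrow> int \<Rightarrow> int" where
  "rank [] s = 0"
| "rank (x # w) s = (if x = R \<and> 0 \<le> s then 1 else 0) + rank w (s - 1)"

text \<open>Frontiers are functions of the diagonal rather than words, so that removing a tile can
  alter a frontier pointwise.\<close>

definition region :: "(int \<Rightarrow> int) \<Rightarrow> (int \<Rightarrow> int) \<Rightarrow> square set" where
  "region f g = {(i, j). f (i + j) \<le> i \<and> i < g (i + j)}"

text \<open>The condition for a lattice path: a diagonal is reached by an up-step (equality) or by a
  right-step (increase).\<close>

definition slow :: "(int \<Rightarrow> int) \<Rightarrow> bool" where
  "slow f \<longleftrightarrow> (\<forall>s. f s = f (s - 1) \<or> f s = f (s - 1) + 1)"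

text \<open>For \<open>rank w\<close> these are the indices of \<open>R\<close> in \<open>w\<close>,
  counted from 0: the beads of the abacus.\<close>

definition rises :: "(int \<Rightarrow> int) \<Rightarrow> int set" where
  "rises f = {s. f s = f (s - 1) + 1}"

lemma slowD: "slow f \<Longrightarrow> f s = f (s - 1) \<or> f s = f (s - 1) + 1"
  by (simp add: slow_def)

lemma rank_neg: "s < 0 \<Longrightarrow> rank w s = 0"
  by (induction w arbitrary: s) auto

lemma slow_rank: "slow (rank w)"
proof (induction w)
  case Nil
  then show ?case by (simp add: slow_def)
next
  case (Cons x w)
  show ?case unfolding slow_def
  proof
    fix s
    show "rank (x # w) s = rank (x # w) (s - 1) \<or> rank (x # w) s = rank (x # w) (s - 1) + 1"
      using slowD[OF Cons.IH, of "s - 1"] rank_neg[of "s - 1" w] rank_neg[of "s - 2" w]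
      by (cases "s \<le> 0") auto
  qed
qed

lemma rank_append: "rank (u @ v) s = rank u s + rank v (s - int (length u))"
  by (induction u arbitrary: s) (auto simp: algebra_simps)

lemma rank_replicate_U: "rank (replicate n U) s = 0"
  by (induction n arbitrary: s) auto

lemma rank_replicate_R: "rank (replicate n R) s = max 0 (min (int n) (s + 1))"
  by (induction n arbitrary: s) auto

text \<open>The lower frontier runs up the left side and along the top, the upper one along the
  bottom and up the right side; \<open>R, U\<close> and \<open>U, R\<close> are the detours round
  the two missing corners.\<close>

lemma M_eq_region:
  assumes "m \<ge> 1" "n \<ge> 1"
  shows "M (int m + 1) (int n + 1) =
    region (rank (replicate m U @ [R, U] @ replicate n R)) (rank (replicate n R @ [U, R] @ replicate m U))"
proof -
  have lower: "rank (replicate m U @ [R, U] @ replicate n R) s =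
      (if s < int m then 0 else if s \<le> int m + 1 then 1 else min (s - int m) (int n + 1))" for s
    by (simp add: rank_append rank_replicate_U rank_replicate_R min_def)
  have upper: "rank (replicate n R @ [U, R] @ replicate m U) s =
      (if s < int n then max 0 (s + 1) else if s = int n then int n else int n + 1)" for s
    by (simp add: rank_append rank_replicate_U rank_replicate_R min_def)
  have "(i, j) \<in> M (int m + 1) (int n + 1) \<longleftrightarrow> (i, j) \<in> region (rank (replicate m U @ [R, U] @ replicate n R))
    (rank (replicate n R @ [U, R] @ replicate m U))" for i j
    unfolding region_def lower upper using assms by (auto simp: M_def split: if_splits)
  then show ?thesis by auto
qed

lemma rises_lower:
  assumes "m \<ge> 1" "n \<ge> 1"
  shows "rises (rank (replicate m U @ [R, U] @ replicate n R)) = insert (int m) {int m + 2..int m + int n + 1}"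
  using assms by (auto simp: rises_def rank_append rank_replicate_U rank_replicate_R max_def min_def split: if_splits)

lemma rises_upper:
  assumes "m \<ge> 1" "n \<ge> 1"
  shows "rises (rank (replicate n R @ [U, R] @ replicate m U)) = insert (int n + 1) {0..int n - 1}"
  using assms by (auto simp: rises_def rank_append rank_replicate_U rank_replicate_R max_def min_def split: if_splits)

text \<open>One square on each of four consecutive diagonals; for slow \<open>h\<close> they form a
  connected ribbon.\<close>

definition ribbon :: "int \<Rightarrow> (int \<Rightarrow> int) \<Rightarrow> square set" where
  "ribbon s h = (\<lambda>k. (h k, k - h k)) ` {s..s + 3}"

text \<open>The initial \<open>U\<close> puts the first square at the origin; each later letter is
  the direction to the next square.\<close>

lemma S_eq_ribbons:
  "S = (\<lambda>w. ribbon 0 (rank w)) ` {[U, R, R, U], [U, R, U, R], [U, U, R, R], [U, U, U, U]}"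
proof -
  have "{0..3} = {0, 1, 2, 3 :: int}" by auto
  then show ?thesis by (auto simp: S_def t2_def t3_def t5_def t8_def ribbon_def)
qed

section \<open>Constructing tilings by rewriting frontiers\<close>

text \<open>The first four rules sweep out \<open>t2\<close>, \<open>t3\<close>, \<open>t5\<close>,
  \<open>t8\<close> in this order; the fifth lets a swap happen further along the path.\<close>

inductive step :: "letter list \<Rightarrow> letter list \<Rightarrow> bool" where
  "step (U # R # R # U # R # w) (R # R # R # U # U # w)"
| "step (U # R # U # R # R # w) (R # R # U # R # U # w)"
| "step (U # U # R # R # R # w) (R # U # R # R # U # w)"
| "step (U # U # U # U # R # w) (R # U # U # U # U # w)"
| "step w w' \<Longrightarrow> step (x # w) (x # w')"

lemma translate_translate: "translate v (translate u A) = translate (fst u + fst v, snd u + snd v) A"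
  by (auto simp: translate_def image_image case_prod_unfold algebra_simps)

lemma mem_translate: "(i, j) \<in> translate v A \<longleftrightarrow> (i - fst v, j - snd v) \<in> A"
  by (force simp: translate_def)

text \<open>The two ranks differ by exactly one on the diagonals 0 to 3 and agree elsewhere, which
  leaves one square on each of these four diagonals.\<close>

lemma region_swap:
  assumes "length e = 3"
  shows "region (rank (U # e @ R # w)) (rank (R # e @ U # w)) = ribbon 0 (rank (U # e))"
    and "rank (U # e @ R # w) s \<le> rank (R # e @ U # w) s"
proof -
  have lower: "rank (U # e @ R # w) s = rank (U # e) s + (if s < 4 then 0 else 1 + rank w (s - 5))" for s
    using assms by (auto simp: rank_append rank_neg)
  have upper: "rank (R # e @ U # w) s =
      rank (U # e) s + (if s < 0 then 0 else if s < 4 then 1 else 1 + rank w (s - 5))" for s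
    using assms by (auto simp: rank_append rank_neg)
  have "(i, j) \<in> region (rank (U # e @ R # w)) (rank (R # e @ U # w)) \<longleftrightarrow> (i, j) \<in> ribbon 0 (rank (U # e))" for i j
    unfolding region_def lower upper ribbon_def by (auto simp del: rank.simps simp: image_iff intro!: bexI[of _ "i + j"])
  then show "region (rank (U # e @ R # w)) (rank (R # e @ U # w)) = ribbon 0 (rank (U # e))"
    by auto
  show "rank (U # e @ R # w) s \<le> rank (R # e @ U # w) s"
    unfolding lower upper by simp
qed

lemma swap_tile:
  assumes "length e = 3" "ribbon 0 (rank (U # e)) \<in> S"
  shows "(\<forall>s. rank (U # e @ R # w) s \<le> rank (R # e @ U # w) s) \<and>
    (\<exists>t\<in>S. \<exists>v. region (rank (U # e @ R # w)) (rank (R # e @ U # w)) = translate v t)"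
proof -
  have "ribbon 0 (rank (U # e)) = translate (0, 0) (ribbon 0 (rank (U # e)))"
    by (auto simp: translate_def)
  then show ?thesis using region_swap[OF assms(1)] assms(2) by metis
qed

lemma step_tile:
  "step w w' \<Longrightarrow> (\<forall>s. rank w s \<le> rank w' s) \<and> (\<exists>t\<in>S. \<exists>v. region (rank w) (rank w') = translate v t)"
proof (induction rule: step.induct)
  case (5 w w' x)
  then obtain t v where t: "t \<in> S" and eq: "region (rank w) (rank w') = translate v t"
    and le: "\<And>s. rank w s \<le> rank w' s" by auto
  \<comment> \<open>A common first letter displaces both paths by one unit: right for
    \<open>R\<close>, up for \<open>U\<close>.\<close>
  define d where "d = (if x = R then (1, 0) else (0, 1) :: int \<times> int)"
  have "region (rank (x # w)) (rank (x # w')) = translate d (region (rank w) (rank w'))"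
  proof -
    have "(i, j) \<in> region (rank (x # w)) (rank (x # w')) \<longleftrightarrow> (i, j) \<in> translate d (region (rank w) (rank w'))" for i j
      using rank_neg[of "i + j - 1" w] rank_neg[of "i + j - 1" w']
      by (cases "i + j < 0"; cases x) (auto simp: region_def d_def mem_translate algebra_simps)
    then show ?thesis by auto
  qed
  then have "region (rank (x # w)) (rank (x # w')) = translate (fst v + fst d, snd v + snd d) t"
    by (simp only: eq translate_translate)
  moreover have "\<forall>s. rank (x # w) s \<le> rank (x # w') s" using le by simp
  ultimately show ?case using t by blast
next
  case (1 w)
  have "ribbon 0 (rank [U, R, R, U]) \<in> S" unfolding S_eq_ribbons by blast
  with swap_tile[of "[R, R, U]" w] show ?case by (simp del: rank.simps)
next
  case (2 w)
  have "ribbon 0 (rank [U, R, U, R]) \<in> S" unfolding S_eq_ribbons by blast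
  with swap_tile[of "[R, U, R]" w] show ?case by (simp del: rank.simps)
next
  case (3 w)
  have "ribbon 0 (rank [U, U, R, R]) \<in> S" unfolding S_eq_ribbons by blast
  with swap_tile[of "[U, R, R]" w] show ?case by (simp del: rank.simps)
next
  case (4 w)
  have "ribbon 0 (rank [U, U, U, U]) \<in> S" unfolding S_eq_ribbons by blast
  with swap_tile[of "[U, U, U]" w] show ?case by (simp del: rank.simps)
qed

lemma tiles_Un:
  assumes "tiles T A" "tiles T B" "A \<inter> B = {}"
  shows "tiles T (A \<union> B)"
proof -
  obtain P where P: "\<forall>p\<in>P. \<exists>t\<in>T. \<exists>v. p = translate v t" "disjoint P" "\<Union> P = A"
    using assms by (auto simp: tiles_def)
  obtain Q where Q: "\<forall>p\<in>Q. \<exists>t\<in>T. \<exists>v. p = translate v t" "disjoint Q" "\<Union> Q = B"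
    using assms by (auto simp: tiles_def)
  have "disjoint (P \<union> Q)"
    using P Q assms by (intro disjoint_union) auto
  then show ?thesis unfolding tiles_def using P Q by (intro exI[of _ "P \<union> Q"]) auto
qed

text \<open>Frontiers only advance, so the regions of successive steps are disjoint and stack up to
  the region between the first and the last frontier.\<close>

lemma steps_tiles:
  "step\<^sup>*\<^sup>* w w' \<Longrightarrow> (\<forall>s. rank w s \<le> rank w' s) \<and> tiles S (region (rank w) (rank w'))"
proof (induction rule: rtranclp_induct)
  case base
  have "region (rank w) (rank w) = {}" by (auto simp: region_def)
  then show ?case by (auto simp: tiles_def intro: exI[of _ "{}"])
next
  case (step y z)
  obtain t v where t: "t \<in> S" and eq: "region (rank y) (rank z) = translate v t"
    and le: "\<And>s. rank y s \<le> rank z s" using step_tile[OF step.hyps(2)] by auto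
  have "tiles S (region (rank y) (rank z))"
    unfolding tiles_def eq
    by (intro exI[of _ "{translate v t}"] conjI) (use t in blast, simp_all)
  moreover have "region (rank w) (rank z) = region (rank w) (rank y) \<union> region (rank y) (rank z)"
    using step.IH le by (fastforce simp: region_def intro: order.trans less_le_trans)
  moreover have "region (rank w) (rank y) \<inter> region (rank y) (rank z) = {}"
    by (auto simp: region_def)
  ultimately have "tiles S (region (rank w) (rank z))"
    using step.IH tiles_Un by metis
  then show ?case using step.IH le by (meson order.trans)
qed

section \<open>Commutation relations between blocks of letters\<close>

lemma step_append: "step w w' \<Longrightarrow> step (w @ v) (w' @ v)"
  by (induction rule: step.induct) (auto intro: step.intros)

lemma step_prepend: "step w w' \<Longrightarrow> step (u @ w) (u @ w')"
  by (induction u) (auto intro: step.intros)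

lemma steps_context: "step\<^sup>*\<^sup>* w w' \<Longrightarrow> step\<^sup>*\<^sup>* (u @ w @ v) (u @ w' @ v)"
  by (induction rule: rtranclp_induct) (auto intro: rtranclp.rtrancl_into_rtrancl step_append step_prepend)

text \<open>Allows a rewriting sequence to be given as the explicit list of its words.\<close>

lemma successively_rtranclp: "successively r (x # xs) \<Longrightarrow> r\<^sup>*\<^sup>* x (last (x # xs))"
  by (induction xs arbitrary: x) (auto intro: converse_rtranclp_into_rtranclp)

lemma commute_power:
  assumes "step\<^sup>*\<^sup>* (x @ replicate k c) (replicate k c @ x)"
  shows "step\<^sup>*\<^sup>* (x @ replicate (k * n) c) (replicate (k * n) c @ x)"
proof (induction n)
  case (Suc n)
  have "step\<^sup>*\<^sup>* (x @ replicate k c @ replicate (k * n) c) (replicate k c @ x @ replicate (k * n) c)"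
    using steps_context[OF assms, of "[]"] by simp
  also have "step\<^sup>*\<^sup>* \<dots> (replicate k c @ replicate (k * n) c @ x)"
    using steps_context[OF Suc.IH, of "replicate k c" "[]"] by simp
  finally show ?case by (simp add: replicate_add)
qed simp

text \<open>Passing a \<open>U\<close> changes nothing and passing an \<open>R\<close> is one swap
  with the vertical tile, so \<open>U^4\<close> passes any word.\<close>

lemma commute_U4:
  "step\<^sup>*\<^sup>* (replicate (4 * k) U @ w) (w @ replicate (4 * k) U)"
proof (induction k)
  case (Suc k)
  have one: "step\<^sup>*\<^sup>* (replicate 4 U @ w) (w @ replicate 4 U)" for w
  proof (induction w)
    case (Cons x w)
    have "step\<^sup>*\<^sup>* (replicate 4 U @ [x]) ([x] @ replicate 4 U)"
      by (cases x) (auto simp: numeral_eq_Suc intro: step.intros)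
    from steps_context[OF this, of "[]" w] steps_context[OF Cons.IH, of "[x]" "[]"]
    show ?case by simp
  qed simp
  have "step\<^sup>*\<^sup>* (replicate 4 U @ replicate (4 * k) U @ w) (replicate 4 U @ w @ replicate (4 * k) U)"
    using steps_context[OF Suc.IH, of "replicate 4 U" "[]"] by simp
  also have "step\<^sup>*\<^sup>* \<dots> (w @ replicate 4 U @ replicate (4 * k) U)"
    using steps_context[OF one, of "[]"] by simp
  finally show ?case by (simp add: replicate_add)
qed simp

lemma commute_URU: "step\<^sup>*\<^sup>* ([U, R, U] @ replicate (2 * n) R) (replicate (2 * n) R @ [U, R, U])"
proof -
  have "step [U, R, U, R, R] [R, R, U, R, U]"
    by (intro step.intros)
  then show ?thesis
    by (intro commute_power) (simp add: numeral_eq_Suc r_into_rtranclp)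
qed

text \<open>The listed words describe a tiling of the rectangle with five rows and eight columns by
  ten tiles.\<close>

lemma commute_U5: "step\<^sup>*\<^sup>* (replicate 5 U @ replicate (8 * n) R) (replicate (8 * n) R @ replicate 5 U)"
proof -
  have "successively step
   [[U,U,U,U,U,R,R,R,R,R,R,R,R],
    [U,R,U,U,U,U,R,R,R,R,R,R,R],
    [U,R,R,U,U,U,U,R,R,R,R,R,R],
    [U,R,R,U,U,R,U,R,R,U,R,R,R],
    [U,R,R,U,R,R,U,R,U,U,R,R,R],
    [R,R,R,U,U,R,U,R,U,U,R,R,R],
    [R,R,R,U,U,R,U,R,R,U,R,R,U],
    [R,R,R,U,R,R,U,R,U,U,R,R,U],
    [R,R,R,R,R,R,U,U,U,U,R,R,U],
    [R,R,R,R,R,R,R,U,U,U,U,R,U],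
    [R,R,R,R,R,R,R,R,U,U,U,U,U]]"
    by (simp, intro conjI step.intros)
  from successively_rtranclp[OF this] show ?thesis
    by (intro commute_power) (simp add: numeral_eq_Suc)
qed

text \<open>Three letters \<open>U\<close> cross eight letters \<open>R\<close>, an area of 24
  squares, in six swaps.\<close>

lemma commute_UURU: "step\<^sup>*\<^sup>* ([U, U, R, U] @ replicate (8 * n) R) (replicate (8 * n) R @ [U, U, R, U])"
proof -
  have "successively step
   [[U,U,R,U,R,R,R,R,R,R,R,R],
    [U,R,R,U,R,U,R,R,R,R,R,R],
    [R,R,R,U,U,U,R,R,R,R,R,R],
    [R,R,R,U,R,U,R,R,U,R,R,R],
    [R,R,R,R,R,U,R,U,U,R,R,R],
    [R,R,R,R,R,U,R,R,U,R,R,U],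
    [R,R,R,R,R,R,R,R,U,U,R,U]]"
    by (simp, intro conjI step.intros)
  from successively_rtranclp[OF this] show ?thesis
    by (intro commute_power) (simp add: numeral_eq_Suc)
qed

text \<open>The four swaps tile \<open>M 3 6\<close>, the smallest case of height three.\<close>

lemma base_UURU: "step\<^sup>*\<^sup>* ([U, U, R, U] @ replicate 5 R) (replicate 5 R @ [U, R, U, U])"
proof -
  have "successively step
   [[U,U,R,U,R,R,R,R,R],
    [U,R,R,U,R,U,R,R,R],
    [R,R,R,U,U,U,R,R,R],
    [R,R,R,U,R,U,R,R,U],
    [R,R,R,R,R,U,R,U,U]]"
    by (simp, intro conjI step.intros)
  from successively_rtranclp[OF this] show ?thesis
    by (simp add: numeral_eq_Suc)
qed


section \<open>Tilings for each admissible residue of the height modulo four\<close>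

lemma tiles_M_sufficient:
  assumes "m \<ge> 1" "n \<ge> 1"
    and "step\<^sup>*\<^sup>* (replicate m U @ [R, U] @ replicate n R) (replicate n R @ [U, R] @ replicate m U)"
  shows "tiles S (M (int m + 1) (int n + 1))"
  using steps_tiles[OF assms(3)] M_eq_region[OF assms(1,2)] by simp

text \<open>\<open>URU\<close> reads both as \<open>U\<close> before the detour \<open>RU\<close>
  and as the detour \<open>UR\<close> before \<open>U\<close>, so it only has to cross an even block
  of \<open>R\<close>.\<close>

lemma steps_2_mod_4:
  "step\<^sup>*\<^sup>* (replicate (4 * k + 1) U @ [R, U] @ replicate (2 * l) R)
     (replicate (2 * l) R @ [U, R] @ replicate (4 * k + 1) U)"
proof -
  have "step\<^sup>*\<^sup>* (replicate (4 * k) U @ [U, R, U] @ replicate (2 * l) R)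
      ([U, R, U] @ replicate (2 * l) R @ replicate (4 * k) U)"
    using commute_U4[of k "[U, R, U] @ replicate (2 * l) R"] by simp
  also have "step\<^sup>*\<^sup>* \<dots> (replicate (2 * l) R @ [U, R, U] @ replicate (4 * k) U)"
    using steps_context[OF commute_URU, of "[]"] by simp
  finally show ?thesis by (simp add: replicate_app_Cons_same)
qed

lemma steps_1_mod_4:
  "step\<^sup>*\<^sup>* (replicate (4 * Suc k) U @ [R, U] @ replicate (8 * l + 1) R)
     (replicate (8 * l + 1) R @ [U, R] @ replicate (4 * Suc k) U)"
proof -
  \<comment> \<open>The last \<open>R\<close> is kept aside: it ends up between \<open>U\<close> and
    \<open>U^4\<close>, while the \<open>R\<close> of the detour joins the front block in its
    place.\<close>
  have eq: "replicate (8 * l + 1) R = replicate (8 * l) R @ [R]" "replicate (8 * l + 1) R = R # replicate (8 * l) R"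
    by (simp_all add: replicate_append_same)
  have "step\<^sup>*\<^sup>* (replicate (4 * k) U @ replicate (4 * 1) U @ [R, U] @ replicate (8 * l) R @ [R])
      (replicate (4 * 1) U @ [R, U] @ replicate (8 * l) R @ [R] @ replicate (4 * k) U)"
    using commute_U4[of k "replicate (4 * 1) U @ [R, U] @ replicate (8 * l) R @ [R]"] by simp
  \<comment> \<open>Moving \<open>U^4\<close> past the \<open>R\<close> of the detour joins it to
    the next \<open>U\<close>, giving the \<open>U^5\<close> that can cross
    \<open>R^(8l)\<close>.\<close>
  also have "step\<^sup>*\<^sup>* \<dots> ([R] @ replicate (4 * 1) U @ [U] @ replicate (8 * l) R @ [R] @ replicate (4 * k) U)"
    using steps_context[OF commute_U4[of 1 "[R]"], of "[]"] by simp
  also have "\<dots> = [R] @ (replicate 5 U @ replicate (8 * l) R) @ [R] @ replicate (4 * k) U"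
    by (simp add: numeral_eq_Suc)
  also have "step\<^sup>*\<^sup>* \<dots> ([R] @ (replicate (8 * l) R @ replicate 5 U) @ [R] @ replicate (4 * k) U)"
    by (rule steps_context[OF commute_U5])
  also have "\<dots> = (R # replicate (8 * l) R @ [U]) @ (replicate (4 * 1) U @ [R]) @ replicate (4 * k) U"
    by (simp add: numeral_eq_Suc)
  also have "step\<^sup>*\<^sup>* \<dots> ((R # replicate (8 * l) R @ [U]) @ ([R] @ replicate (4 * 1) U) @ replicate (4 * k) U)"
    by (rule steps_context[OF commute_U4])
  also have "replicate (4 * k) U @ replicate (4 * 1) U @ [R, U] @ replicate (8 * l) R @ [R]
      = replicate (4 * Suc k) U @ [R, U] @ replicate (8 * l + 1) R"
    unfolding eq(1) by (simp add: replicate_add[symmetric] add.commute)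
  also have "(R # replicate (8 * l) R @ [U]) @ ([R] @ replicate (4 * 1) U) @ replicate (4 * k) U
      = replicate (8 * l + 1) R @ [U, R] @ replicate (4 * Suc k) U"
    unfolding eq(2) by (simp add: replicate_add)
  finally show ?thesis .
qed

text \<open>Once \<open>U^(4k)\<close> has moved away, \<open>UURU\<close> crosses
  \<open>R^(8l)\<close> unchanged and the last five \<open>R\<close> reverse it to
  \<open>URUU\<close>.\<close>

lemma steps_3_mod_4:
  "step\<^sup>*\<^sup>* (replicate (4 * k + 2) U @ [R, U] @ replicate (8 * l + 5) R)
     (replicate (8 * l + 5) R @ [U, R] @ replicate (4 * k + 2) U)"
proof -
  have "step\<^sup>*\<^sup>* (replicate (4 * k) U @ [U, U, R, U] @ replicate (8 * l) R @ replicate 5 R)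
      ([U, U, R, U] @ replicate (8 * l) R @ replicate 5 R @ replicate (4 * k) U)"
    using commute_U4[of k "[U, U, R, U] @ replicate (8 * l) R @ replicate 5 R"] by simp
  also have "step\<^sup>*\<^sup>* \<dots> (replicate (8 * l) R @ [U, U, R, U] @ replicate 5 R @ replicate (4 * k) U)"
    using steps_context[OF commute_UURU, of "[]"] by simp
  also have "step\<^sup>*\<^sup>* \<dots> (replicate (8 * l) R @ replicate 5 R @ [U, R, U, U] @ replicate (4 * k) U)"
    using steps_context[OF base_UURU] by simp
  also have "replicate (4 * k) U @ [U, U, R, U] @ replicate (8 * l) R @ replicate 5 R
      = replicate (4 * k + 2) U @ [R, U] @ replicate (8 * l + 5) R"
    by (simp add: replicate_add numeral_2_eq_2 replicate_app_Cons_same)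
  also have "replicate (8 * l) R @ replicate 5 R @ [U, R, U, U] @ replicate (4 * k) U
      = replicate (8 * l + 5) R @ [U, R] @ replicate (4 * k + 2) U"
    by (simp add: replicate_add replicate_app_Cons_same replicate_append_same numeral_2_eq_2)
  finally show ?thesis .
qed


section \<open>Removing a tile\<close>

lemma mem_ribbon: "(i, j) \<in> ribbon s h \<longleftrightarrow> s \<le> i + j \<and> i + j \<le> s + 3 \<and> i = h (i + j)"
  by (auto simp: ribbon_def image_iff intro!: bexI[of _ "i + j"])

lemma card_ribbon: "card (ribbon s h) = 4"
proof -
  have "inj_on (\<lambda>k. (h k, k - h k)) {s..s + 3}" by (auto simp: inj_on_def)
  then show ?thesis by (simp add: ribbon_def card_image)
qed

text \<open>All that the necessity proof retains of the tiles in \<open>S\<close>; the even number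
  of \<open>R\<close> becomes the even rise of \<open>h\<close>.\<close>

lemma tile_ribbon:
  assumes "t \<in> S"
  obtains s h where "translate v t = ribbon s h" "slow h" "even (h (s + 3) - h s)"
proof -
  obtain w where w: "w \<in> {[U, R, R, U], [U, R, U, R], [U, U, R, R], [U, U, U, U]}" "t = ribbon 0 (rank w)"
    using assms S_eq_ribbons by auto
  define s h where "s = fst v + snd v" and "h = (\<lambda>k. fst v + rank w (k - s))"
  have "(i, j) \<in> translate v t \<longleftrightarrow> (i, j) \<in> ribbon s h" for i j
    unfolding mem_translate w(2) mem_ribbon s_def h_def by (auto simp: algebra_simps)
  then have "translate v t = ribbon s h" by auto
  moreover have "slow h"
    unfolding slow_def
  proof
    show "h k = h (k - 1) \<or> h k = h (k - 1) + 1" for k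
      using slowD[OF slow_rank, of w "k - s"] by (simp add: h_def algebra_simps)
  qed
  moreover have "even (h (s + 3) - h s)" using w(1) by (auto simp: h_def)
  ultimately show ?thesis using that by blast
qed

text \<open>The removable tile is the one with the largest starting diagonal among the tiles that begin
  on the lower frontier directly after an up-step: if the frontier left this tile, or did not turn
  right at its end, then another tile of this kind would begin on a later diagonal.\<close>

lemma removable_ribbon:
  assumes f: "slow f" and g: "slow g"
    and fin: "finite (region f g)" and ne: "region f g \<noteq> {}"
    and rib: "\<And>p. p \<in> P \<Longrightarrow> \<exists>s h. p = ribbon s h \<and> slow h \<and> even (h (s + 3) - h s)"
    and disj: "disjoint P" and cover: "\<Union> P = region f g"
  obtains s where "ribbon s f \<in> P" "even (f (s + 3) - f s)" "f (s - 1) = f s" "f (s + 4) = f (s + 3) + 1"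
proof -
  have cell: "f k \<le> h k" "h k < g k" if "ribbon s h \<in> P" "s \<le> k" "k \<le> s + 3" for s h k
  proof -
    have "(h k, k - h k) \<in> region f g"
      using that cover by (metis UnionI mem_ribbon add.commute diff_add_cancel)
    then show "f k \<le> h k" "h k < g k" by (auto simp: region_def)
  qed
  have below: "(f k, k - f k) \<in> \<Union> P" if "f k < g k" for k
    using that cover by (auto simp: region_def)
  define A where "A = {s. f (s - 1) = f s \<and>
    (\<exists>h. ribbon s h \<in> P \<and> slow h \<and> even (h (s + 3) - h s) \<and> h s = f s)}"
  \<comment> \<open>A tile covering the frontier square on diagonal \<open>s\<close> either begins
    there or also contains the square directly below it; \<open>sep\<close> rules out the
    latter.\<close>
  have entry: "s \<in> A" if "f (s - 1) = f s" "f s < g s"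
    and sep: "\<And>p. p \<in> P \<Longrightarrow> (f s, s - f s) \<in> p \<Longrightarrow> (f s, s - 1 - f s) \<notin> p" for s
  proof -
    obtain p where p: "p \<in> P" "(f s, s - f s) \<in> p" using below[OF \<open>f s < g s\<close>] by auto
    obtain s' h where h: "p = ribbon s' h" "slow h" "even (h (s' + 3) - h s')" using rib[OF p(1)] by auto
    have s': "s' \<le> s" "s \<le> s' + 3" "h s = f s" using p(2) by (auto simp: h mem_ribbon)
    have "s' = s"
    proof (rule ccontr)
      assume "s' \<noteq> s"
      then have "f (s - 1) \<le> h (s - 1)" using cell[of s' h "s - 1"] p(1) s' h by auto
      then have "h (s - 1) = f s" using slowD[OF h(2), of s] s' that(1) by auto
      then have "(f s, s - 1 - f s) \<in> p" using s' \<open>s' \<noteq> s\<close> by (auto simp: h mem_ribbon)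
      then show False using sep p by blast
    qed
    then show ?thesis using that(1) h p s' by (auto simp: A_def)
  qed
  have sup: "finite {s. f s < g s}"
  proof (rule finite_subset)
    show "{s. f s < g s} \<subseteq> (\<lambda>(i, j). i + j) ` region f g"
    proof
      fix k
      assume "k \<in> {s. f s < g s}"
      then have "(f k, k - f k) \<in> region f g" by (simp add: region_def)
      then have "(\<lambda>(i, j). i + j) (f k, k - f k) \<in> (\<lambda>(i, j). i + j) ` region f g" by (rule imageI)
      then show "k \<in> (\<lambda>(i, j). i + j) ` region f g" by simp
    qed
  qed (use fin in auto)
  have "A \<subseteq> {s. f s < g s}"
  proof
    fix s
    assume "s \<in> A"
    then obtain h where "ribbon s h \<in> P" "h s = f s" by (auto simp: A_def)
    then show "s \<in> {s. f s < g s}" using cell(2)[of s h s] by simp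
  qed
  then have finA: "finite A" using sup finite_subset by blast
  have "A \<noteq> {}"
  proof -
    obtain i j where "(i, j) \<in> region f g" using ne by auto
    then have "f (i + j) < g (i + j)" by (simp add: region_def)
    then have nonempty: "{s. f s < g s} \<noteq> {}" by blast
    \<comment> \<open>On the first diagonal meeting the region the lower frontier must go up, or the
      upper one could not overtake it; the square below is outside the region, so a tile begins
      here.\<close>
    define m where "m = Min {s. f s < g s}"
    have m: "f m < g m" using Min_in[OF sup nonempty] by (simp add: m_def)
    have le: "g (m - 1) \<le> f (m - 1)"
    proof (rule ccontr)
      assume "\<not> g (m - 1) \<le> f (m - 1)"
      then have "m \<le> m - 1" unfolding m_def by (intro Min_le[OF sup]) (simp add: m_def)
      then show False by simp
    qed
    then have eq: "f (m - 1) = f m" using m slowD[OF f, of m] slowD[OF g, of m] by auto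
    have "(f m, m - 1 - f m) \<notin> region f g" using le eq by (simp add: region_def)
    then have "(f m, m - 1 - f m) \<notin> p" if "p \<in> P" for p using that cover by blast
    then have "m \<in> A" using entry eq m by blast
    then show ?thesis by auto
  qed
  define s where "s = Max A"
  have "s \<in> A" using finA \<open>A \<noteq> {}\<close> by (simp add: s_def)
  have later: "k \<notin> A" if "s < k" for k using that Max_ge[OF finA, of k] by (auto simp: s_def)
  obtain h where h: "ribbon s h \<in> P" "slow h" "even (h (s + 3) - h s)" "h s = f s" and "f (s - 1) = f s"
    using \<open>s \<in> A\<close> by (auto simp: A_def)
  \<comment> \<open>The square below the uncovered one belongs to the chosen tile, so another tile
    begins at \<open>k + 1\<close>, against maximality. This serves both for leaving the frontier
    and, with \<open>k = s + 3\<close>, for the missing right turn.\<close>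
  have blocked: False
    if k: "s \<le> k" "k \<le> s + 3" "h k = f k" "f (k + 1) = f k" "f (k + 1) < g (k + 1)"
      and out: "(f (k + 1), k + 1 - f (k + 1)) \<notin> ribbon s h" for k
  proof -
    have on: "(f k, k - f k) \<in> ribbon s h" using k by (simp add: mem_ribbon)
    have "k + 1 \<in> A"
    proof (rule entry)
      show "f (k + 1 - 1) = f (k + 1)" "f (k + 1) < g (k + 1)" using k by auto
      show "(f (k + 1), k + 1 - 1 - f (k + 1)) \<notin> p" if p: "p \<in> P" "(f (k + 1), k + 1 - f (k + 1)) \<in> p" for p
      proof -
        have "p \<noteq> ribbon s h" using p out by auto
        then have "p \<inter> ribbon s h = {}" using disjointD[OF disj p(1) h(1)] by simp
        then show ?thesis using on k by auto
      qed
    qed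
    then show False using later[of "k + 1"] k by auto
  qed
  have ext: "h (s + int n) = f (s + int n)" if "n \<le> 3" for n
    using that
  proof (induction n)
    case 0
    then show ?case using h by simp
  next
    case (Suc n)
    define k where "k = s + int n"
    have k: "s \<le> k" "k + 1 \<le> s + 3" "h k = f k" using Suc by (auto simp: k_def)
    have "h (k + 1) = f (k + 1)"
    proof (rule ccontr)
      assume neq: "h (k + 1) \<noteq> f (k + 1)"
      have c: "f (k + 1) \<le> h (k + 1)" "h (k + 1) < g (k + 1)" using cell[OF h(1), of "k + 1"] k by auto
      have "f (k + 1) = f k" using slowD[OF f, of "k + 1"] slowD[OF h(2), of "k + 1"] c neq k by auto
      then show False using blocked[of k] k c neq by (auto simp: mem_ribbon)
    qed
    then show ?case by (simp add: k_def algebra_simps)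
  qed
  have eq: "h k = f k" if "s \<le> k" "k \<le> s + 3" for k
    using ext[of "nat (k - s)"] that by simp
  have "ribbon s h = ribbon s f" unfolding ribbon_def using eq by (intro image_cong) auto
  moreover have "even (f (s + 3) - f s)" using h(3) eq by simp
  moreover have "f (s + 4) = f (s + 3) + 1"
  proof (rule ccontr)
    assume "f (s + 4) \<noteq> f (s + 3) + 1"
    then have e: "f (s + 4) = f (s + 3)" using slowD[OF f, of "s + 4"] by (auto simp: add.commute)
    have "g (s + 3) \<le> g (s + 4)" using slowD[OF g, of "s + 4"] by (auto simp: add.commute)
    then have "f (s + 4) < g (s + 4)" using cell(2)[OF h(1), of "s + 3"] eq[of "s + 3"] e by simp
    then show False using blocked[of "s + 3"] e eq by (auto simp: mem_ribbon add.commute)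
  qed
  ultimately show ?thesis using that h(1) \<open>f (s - 1) = f s\<close> by metis
qed

section \<open>Inversions\<close>

text \<open>The inversion number of the sequence of runners, read off the beads in increasing
  order.\<close>

definition inversions :: "int set \<Rightarrow> nat" where
  "inversions X = card {(p, q). p \<in> X \<and> q \<in> X \<and> p < q \<and> p mod 4 > q mod 4}"

definition partners :: "int \<Rightarrow> int set \<Rightarrow> int set" where
  "partners x Y = {y \<in> Y. y < x \<and> y mod 4 > x mod 4 \<or> x < y \<and> x mod 4 > y mod 4}"

lemma inversions_insert:
  assumes "finite Y" "x \<notin> Y"
  shows "inversions (insert x Y) = inversions Y + card (partners x Y)"
proof -
  let ?I = "{(p, q). p \<in> Y \<and> q \<in> Y \<and> p < q \<and> p mod 4 > q mod 4}"
  let ?J = "(\<lambda>y. if y < x then (y, x) else (x, y)) ` partners x Y"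
  have "{(p, q). p \<in> insert x Y \<and> q \<in> insert x Y \<and> p < q \<and> p mod 4 > q mod 4} = ?I \<union> ?J"
    by (auto simp: partners_def image_iff)
  moreover have "?I \<inter> ?J = {}" using assms(2) by (auto split: if_splits)
  moreover have "finite ?I" by (rule finite_subset[of _ "Y \<times> Y"]) (use assms in auto)
  moreover have "finite ?J" using assms by (simp add: partners_def)
  moreover have "card ?J = card (partners x Y)"
    by (rule card_image) (use assms(2) in \<open>auto simp: inj_on_def partners_def split: if_splits\<close>)
  ultimately show ?thesis unfolding inversions_def by (simp add: card_Un_disjoint)
qed

text \<open>The moved bead stays on its runner, so its relation to \<open>y\<close> flips exactly
  when it passes \<open>y\<close> on another runner; these \<open>y\<close> form the symmetric
  difference of the two partner sets.\<close>

lemma inversions_move: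
  assumes "finite Y" "x \<notin> Y" "z \<notin> Y" "x \<le> z" "z mod 4 = x mod 4"
  shows "even (inversions (insert x Y) + inversions (insert z Y)) \<longleftrightarrow>
    even (card {y \<in> Y. x < y \<and> y < z \<and> y mod 4 \<noteq> x mod 4})"
proof -
  let ?B = "partners x Y" and ?C = "partners z Y"
  have fin: "finite ?B" "finite ?C" using assms(1) by (auto simp: partners_def)
  have "{y \<in> Y. x < y \<and> y < z \<and> y mod 4 \<noteq> x mod 4} = (?B - ?C) \<union> (?C - ?B)"
    using assms by (auto simp: partners_def not_less order.order_iff_strict)
  then have "card {y \<in> Y. x < y \<and> y < z \<and> y mod 4 \<noteq> x mod 4} = card (?B - ?C) + card (?C - ?B)"
    using fin by (subst card_Un_disjoint[symmetric]) auto
  moreover have "card ?B = card (?B \<inter> ?C) + card (?B - ?C)" "card ?C = card (?B \<inter> ?C) + card (?C - ?B)"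
    using card_Int_Diff[OF fin(1), of ?C] card_Int_Diff[OF fin(2), of ?B] by (simp_all add: Int_commute)
  ultimately show ?thesis using assms by (auto simp: inversions_insert)
qed

lemma inversions_shift: "inversions ((\<lambda>x. x + 4 * k) ` X) = inversions X"
proof -
  let ?f = "\<lambda>(p, q). (p + 4 * k, q + 4 * k)"
  have "{(p, q). p \<in> (\<lambda>x. x + 4 * k) ` X \<and> q \<in> (\<lambda>x. x + 4 * k) ` X \<and> p < q \<and> p mod 4 > q mod 4}
      = ?f ` {(p, q). p \<in> X \<and> q \<in> X \<and> p < q \<and> p mod 4 > q mod 4}"
    by (auto simp: image_iff)
  then show ?thesis unfolding inversions_def by (simp add: card_image inj_on_def split_beta)
qed

lemma rises_interval:
  assumes "slow f"
  shows "int (card {y \<in> rises f. s < y \<and> y \<le> s + int n}) = f (s + int n) - f s"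
proof (induction n)
  case 0
  then show ?case by auto
next
  case (Suc n)
  let ?X = "{y \<in> rises f. s < y \<and> y \<le> s + int n}" and ?z = "s + int (Suc n)"
  have "y \<le> ?z \<longleftrightarrow> y \<le> s + int n \<or> y = ?z" "s < ?z" for y by auto
  then have split: "{y \<in> rises f. s < y \<and> y \<le> ?z} = (if ?z \<in> rises f then insert ?z ?X else ?X)"
    by auto
  have "?z \<notin> ?X" by simp
  moreover have "finite ?X" by (rule finite_subset[of _ "{s..s + int n}"]) auto
  moreover have "?z \<in> rises f \<longleftrightarrow> f ?z = f (s + int n) + 1" by (simp add: rises_def)
  moreover have "f ?z = f (s + int n) \<or> f ?z = f (s + int n) + 1" using slowD[OF assms, of ?z] by simp
  ultimately show ?case unfolding split using Suc by auto
qed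

text \<open>By induction on the number of tiles, the lower frontier is pushed across a removable
  tile, which moves one bead from \<open>s + 4\<close> to \<open>s\<close> past an even number of
  beads, until it meets \<open>g\<close>.\<close>

lemma inversions_invariant:
  assumes "finite P" "slow f" "slow g" "\<And>s. f s \<le> g s" "finite (rises f)" "finite (region f g)"
    and "\<And>p. p \<in> P \<Longrightarrow> \<exists>s h. p = ribbon s h \<and> slow h \<and> even (h (s + 3) - h s)"
    and "disjoint P" "\<Union> P = region f g"
  shows "even (inversions (rises f) + inversions (rises g))"
  using assms
proof (induction "card P" arbitrary: P f)
  case 0
  then have "region f g = {}" by simp
  then have "g s \<le> f s" for s
    by (force simp: region_def dest: spec[of _ "f s"] spec[of _ "s - f s"])
  then have "f = g" using 0 by (intro ext antisym) auto
  then show ?case by simp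
next
  case (Suc n)
  have "region f g \<noteq> {}"
  proof
    assume e: "region f g = {}"
    obtain p where "p \<in> P" using Suc.hyps(2) by (metis card.empty ex_in_conv nat.distinct(1))
    then have "card p = 4" "p = {}" using Suc.prems(7,9) e card_ribbon by blast+
    then show False by simp
  qed
  then obtain s where p: "ribbon s f \<in> P" and ev: "even (f (s + 3) - f s)"
    and s: "f (s - 1) = f s" "f (s + 4) = f (s + 3) + 1"
    using removable_ribbon[OF Suc.prems(2,3,6) _ Suc.prems(7,8,9)] by metis
  have s': "f (s + 4) = f (3 + s) + 1" using s(2) by (simp add: add.commute)
  \<comment> \<open>The up-step before \<open>s\<close> and the right-step into \<open>s + 4\<close>
    trade places, which keeps the new frontier slow.\<close>
  define f' where "f' = (\<lambda>k. if s \<le> k \<and> k \<le> s + 3 then f k + 1 else f k)"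
  have "slow f'"
    unfolding slow_def
  proof
    fix k
    have "f' (s + 4) = f' (s + 3)" using s by (simp add: f'_def)
    moreover have "k = s + 4 \<Longrightarrow> k - 1 = s + 3" by simp
    ultimately have "k = s + 4 \<Longrightarrow> f' k = f' (k - 1)" by metis
    moreover have "f' k = f' (k - 1) \<or> f' k = f' (k - 1) + 1" if "k \<noteq> s + 4"
      using slowD[OF Suc.prems(2), of k] s that by (cases "k = s") (auto simp: f'_def)
    ultimately show "f' k = f' (k - 1) \<or> f' k = f' (k - 1) + 1" by blast
  qed
  have lt: "f k < g k" if "s \<le> k" "k \<le> s + 3" for k
  proof -
    have "(f k, k - f k) \<in> ribbon s f" using that by (simp add: mem_ribbon)
    then have "(f k, k - f k) \<in> region f g" using p Suc.prems(9) by blast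
    then show ?thesis by (simp add: region_def)
  qed
  have le: "f' k \<le> g k" for k using lt[of k] Suc.prems(4)[of k] by (auto simp: f'_def)
  have reg: "region f' g = region f g - ribbon s f"
    using lt by (auto simp: region_def f'_def mem_ribbon split: if_splits)
  have eq: "\<Union> (P - {ribbon s f}) = region f' g"
    unfolding reg using diff_Union_pairwise_disjoint[OF Suc.prems(8), of "{ribbon s f}"] p Suc.prems(9) by simp
  define Y where "Y = rises f - {s + 4}"
  have rf: "rises f = insert (s + 4) Y" using s s' by (auto simp: Y_def rises_def)
  have rf': "rises f' = insert s Y"
  proof -
    have "k \<in> rises f' \<longleftrightarrow> k \<in> insert s Y" for k
    proof -
      consider "k = s" | "k = s + 4" | "k \<noteq> s" "k \<noteq> s + 4" by blast
      then show ?thesis using s s' by cases (auto simp: f'_def rises_def Y_def)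
    qed
    then show ?thesis by auto
  qed
  have Y: "finite Y" "s \<notin> Y" "s + 4 \<notin> Y" using Suc.prems(5) s by (auto simp: Y_def rises_def)
  \<comment> \<open>No integer strictly between \<open>s\<close> and \<open>s + 4\<close> shares the
    residue of \<open>s\<close>, so all beads there count; their number is the even rise along the
    tile.\<close>
  have "{y \<in> Y. s < y \<and> y < s + 4 \<and> y mod 4 \<noteq> s mod 4} = {y \<in> rises f. s < y \<and> y \<le> s + int 3}"
  proof -
    have "y mod 4 \<noteq> s mod 4" if "s < y" "y < s + 4" for y using that by presburger
    then show ?thesis by (auto simp: Y_def)
  qed
  then have "even (card {y \<in> Y. s < y \<and> y < s + 4 \<and> y mod 4 \<noteq> s mod 4})"
    using rises_interval[OF Suc.prems(2), of s 3] ev by (metis even_of_nat of_nat_numeral)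
  then have "even (inversions (rises f') + inversions (rises f))"
    unfolding rf rf' using inversions_move[of Y s "s + 4"] Y by simp
  moreover have "even (inversions (rises f') + inversions (rises g))"
  proof (rule Suc.hyps(1))
    show "n = card (P - {ribbon s f})" using Suc.hyps(2) Suc.prems(1) p by simp
    show "disjoint (P - {ribbon s f})" using Suc.prems(8) by (simp add: disjoint_def)
    show "finite (region f' g)" unfolding reg using Suc.prems(6) by simp
  qed (use Suc.prems \<open>slow f'\<close> le eq Y rf' in auto)
  ultimately show ?case by (simp add: even_add)
qed

section \<open>Necessary conditions\<close>

lemma finite_M: "finite (M a b)"
  by (rule finite_subset[of _ "{0..<b} \<times> {0..<a}"]) (auto simp: M_def)

lemma card_M:
  assumes "a > 1" "b > 1"
  shows "int (card (M a b)) = a * b - 2"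
proof -
  have "M a b = {0..<b} \<times> {0..<a} - {(0, a - 1), (b - 1, 0)}" by (auto simp: M_def)
  then have "card (M a b) = nat b * nat a - 2" using assms by (simp add: card_Diff_subset)
  \<comment> \<open>Ensures that the subtraction of natural numbers does not truncate.\<close>
  moreover have "2 * 1 \<le> nat b * nat a" using assms by (intro mult_mono) auto
  ultimately show ?thesis using assms by (simp add: of_nat_diff)
qed

lemma tiles_S_ribbons:
  assumes "tiles S A" "finite A"
  obtains P where "finite P" "\<And>p. p \<in> P \<Longrightarrow> \<exists>s h. p = ribbon s h \<and> slow h \<and> even (h (s + 3) - h s)"
    "disjoint P" "\<Union> P = A"
proof -
  obtain P where P: "\<forall>p\<in>P. \<exists>t\<in>S. \<exists>v. p = translate v t" "disjoint P" "\<Union> P = A"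
    using assms(1) by (auto simp: tiles_def)
  show ?thesis
  proof
    show "finite P" using P(3) assms(2) finite_UnionD by blast
    show "\<exists>s h. p = ribbon s h \<and> slow h \<and> even (h (s + 3) - h s)" if "p \<in> P" for p
      using that P(1) by (metis tile_ribbon)
  qed (use P in auto)
qed

lemma tiles_M_area:
  assumes "tiles S (M a b)" "a > 1" "b > 1"
  shows "4 dvd a * b - 2"
proof -
  obtain P where P: "finite P" "\<And>p. p \<in> P \<Longrightarrow> \<exists>s h. p = ribbon s h \<and> slow h \<and> even (h (s + 3) - h s)"
    "disjoint P" "\<Union> P = M a b"
    using tiles_S_ribbons[OF assms(1) finite_M] by metis
  have four: "card p = 4" if "p \<in> P" for p using P(2)[OF that] card_ribbon by auto
  have "card (M a b) = (\<Sum>p\<in>P. card p)"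
    unfolding P(4)[symmetric] using P four by (intro card_Union_disjoint) (auto simp: disjoint_def pairwise_def disjnt_def card_ge_0_finite)
  then have "card (M a b) = 4 * card P" using four by simp
  then have "a * b - 2 = 4 * int (card P)" using card_M[OF assms(2,3)] by simp
  then show ?thesis by simp
qed

text \<open>The two sets are the bead positions of \<open>U^m R U R^n\<close> and
  \<open>R^n U R U^m\<close>, with \<open>m = a - 1\<close> and \<open>n = b - 1\<close>.\<close>

lemma tiles_M_inversions:
  assumes "tiles S (M a b)" "a > 1" "b > 1"
  shows "even (inversions (insert (a - 1) {a + 1..a + b - 1}) + inversions (insert b {0..b - 2}))"
proof -
  define m n where "m = nat (a - 1)" and "n = nat (b - 1)"
  have mn: "m \<ge> 1" "n \<ge> 1" "a = int m + 1" "b = int n + 1" using assms by (auto simp: m_def n_def)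
  define f g where "f = rank (replicate m U @ [R, U] @ replicate n R)"
    and "g = rank (replicate n R @ [U, R] @ replicate m U)"
  have M: "M a b = region f g" using M_eq_region[OF mn(1,2)] by (simp add: mn f_def g_def)
  obtain P where P: "finite P" "\<And>p. p \<in> P \<Longrightarrow> \<exists>s h. p = ribbon s h \<and> slow h \<and> even (h (s + 3) - h s)"
    "disjoint P" "\<Union> P = M a b"
    using tiles_S_ribbons[OF assms(1) finite_M] by metis
  have rf: "rises f = insert (a - 1) {a + 1..a + b - 1}"
    using rises_lower[OF mn(1,2)] by (simp add: f_def mn algebra_simps)
  have rg: "rises g = insert b {0..b - 2}"
    using rises_upper[OF mn(1,2)] by (simp add: g_def mn algebra_simps)
  have "f s \<le> g s" for s
    using mn(1,2) by (simp add: f_def g_def rank_append rank_replicate_U rank_replicate_R max_def min_def)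
  then show ?thesis
    using inversions_invariant[of P f g] P rf rg M finite_M[of a b] slow_rank
    by (simp add: f_def g_def)
qed

section \<open>Residue counts and the condition modulo eight\<close>

lemma card_interval_residue_1: "card {y \<in> {2..4 * int m}. y mod 4 \<noteq> 1} = 3 * m"
proof (induction m)
  case (Suc m)
  have "{y \<in> {2..4 * int (Suc m)}. y mod 4 \<noteq> 1} =
      {y \<in> {2..4 * int m}. y mod 4 \<noteq> 1} \<union> {4 * int m + 2, 4 * int m + 3, 4 * int m + 4}"
    by (auto simp: set_eq_iff) presburger+
  moreover have "finite {y. l \<le> y \<and> y \<le> 4 * int m \<and> y mod 4 \<noteq> r}" for l r
    by (rule finite_subset[of _ "{l..4 * int m}"]) auto
  ultimately show ?case using Suc by (simp add: card_insert_if)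
qed simp

lemma card_interval_residue_2: "card {y \<in> {0..4 * int m}. y mod 4 \<noteq> 2} = 3 * m + 1"
proof (induction m)
  case 0
  have "{y \<in> {0..4 * int 0}. y mod 4 \<noteq> 2} = {0}" by auto
  then show ?case by simp
next
  case (Suc m)
  have "{y \<in> {0..4 * int (Suc m)}. y mod 4 \<noteq> 2} =
      {y \<in> {0..4 * int m}. y mod 4 \<noteq> 2} \<union> {4 * int m + 1, 4 * int m + 3, 4 * int m + 4}"
    by (auto simp: set_eq_iff) presburger+
  moreover have "finite {y. l \<le> y \<and> y \<le> 4 * int m \<and> y mod 4 \<noteq> r}" for l r
    by (rule finite_subset[of _ "{l..4 * int m}"]) auto
  ultimately show ?case using Suc by (simp add: card_insert_if)
qed

text \<open>Up to a shift by a multiple of four, the two bead sets differ by the position of a single bead.\<close>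

lemma tiles_M_1_mod_4:
  assumes "tiles S (M (4 * k + 1) (4 * int m + 2))" "k \<ge> 1"
  shows "even m"
proof -
  let ?b = "4 * int m + 2"
  have "even (inversions (insert (4 * k) {4 * k + 2..4 * k + ?b}) + inversions (insert ?b {0..?b - 2}))"
    using tiles_M_inversions[OF assms(1)] assms(2) by (simp add: algebra_simps)
  moreover have "insert (4 * k) {4 * k + 2..4 * k + ?b} = (\<lambda>x. x + 4 * k) ` insert 0 {2..?b}"
    by (simp add: image_add_atLeastAtMost' add.commute)
  ultimately have ev: "even (inversions (insert 0 {2..?b}) + inversions (insert ?b {0..?b - 2}))"
    by (simp only: inversions_shift)
  show ?thesis
  \<comment> \<open>For \<open>m = 0\<close> both bead sets are \<open>{0, 2}\<close>; otherwise
    they share \<open>Y\<close> and differ by a bead at \<open>?b - 1\<close> against one at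
    1.\<close>
  proof (cases "m = 0")
    case False
    define Y where "Y = {0, ?b} \<union> {2..?b - 2}"
    have "insert 0 {2..?b} = insert (?b - 1) Y" "insert ?b {0..?b - 2} = insert 1 Y"
      using False by (auto simp: Y_def)
    moreover have "{y \<in> Y. 1 < y \<and> y < ?b - 1 \<and> y mod 4 \<noteq> 1 mod 4} = {y \<in> {2..4 * int m}. y mod 4 \<noteq> 1}"
      by (auto simp: Y_def)
    moreover have "finite Y" "1 \<notin> Y" "?b - 1 \<notin> Y" "1 \<le> ?b - 1" "(?b - 1) mod 4 = 1 mod 4"
      using False by (auto simp: Y_def)
    \<comment> \<open>The bead passes \<open>3 * m\<close> beads on other runners, a number with the
      parity of \<open>m\<close>.\<close>
    ultimately show ?thesis
      using inversions_move[of Y 1 "?b - 1"] ev card_interval_residue_1[of m] by (simp add: add.commute)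
  qed simp
qed

lemma tiles_M_3_mod_4:
  assumes "tiles S (M (4 * k + 3) (4 * int m + 2))" "k \<ge> 0"
  shows "odd m"
proof -
  let ?b = "4 * int m + 2"
  have "even (inversions (insert (4 * k + 2) {4 * k + 4..4 * k + 2 + ?b}) + inversions (insert ?b {0..?b - 2}))"
    using tiles_M_inversions[OF assms(1)] assms(2) by (simp add: algebra_simps)
  \<comment> \<open>Shifting by \<open>4 * (k + 1)\<close> makes the intervals coincide, leaving a
    bead at -2 against one at \<open>?b\<close>.\<close>
  moreover have "insert (4 * k + 2) {4 * k + 4..4 * k + 2 + ?b} = (\<lambda>x. x + 4 * (k + 1)) ` insert (- 2) {0..?b - 2}"
    by (simp add: image_add_atLeastAtMost' algebra_simps)
  ultimately have ev: "even (inversions (insert (- 2) {0..?b - 2}) + inversions (insert ?b {0..?b - 2}))"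
    by (simp only: inversions_shift)
  have "(?b - (- 2)) mod 4 = 0" by presburger
  then have "?b mod 4 = (- 2) mod 4" by presburger
  moreover have "{y \<in> {0..?b - 2}. - 2 < y \<and> y < ?b \<and> y mod 4 \<noteq> (- 2) mod 4} = {y \<in> {0..4 * int m}. y mod 4 \<noteq> 2}"
    by auto
  \<comment> \<open>Here \<open>3 * m + 1\<close> beads are passed, so the parity condition on
    \<open>m\<close> is reversed.\<close>
  ultimately show ?thesis
    using inversions_move[of "{0..?b - 2}" "- 2" ?b] ev card_interval_residue_2[of m] by simp
qed

theorem theorem5p2:
  fixes a b :: int
  assumes "a > 1" and "b > 1"
  shows "tiles S (M a b) \<longleftrightarrow>
    ([a = 2] (mod 4) \<and> odd b) \<or> (odd a \<and> [a * b = 2] (mod 8))"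
proof
  assume t: "tiles S (M a b)"
  have area: "a * b mod 4 = 2" using tiles_M_area[OF t assms] by presburger
  show "([a = 2] (mod 4) \<and> odd b) \<or> (odd a \<and> [a * b = 2] (mod 8))"
  proof (cases "odd a")
    \<comment> \<open>For even height the area alone decides.\<close>
    case False
    then have "a mod 4 = 0 \<or> a mod 4 = 2" by presburger
    then have "a mod 4 = 2"
      using area by (metis mod_mult_left_eq mult_zero_left mod_0 zero_neq_numeral)
    moreover have "odd b"
    proof
      assume "even b"
      then have "4 dvd a * b" using False by (metis mult_dvd_mono numeral_Bit0_eq_double mult_2 mult_numeral_1)
      then show False using area by presburger
    qed
    ultimately show ?thesis by (simp add: cong_def)
  next
    \<comment> \<open>The area forces \<open>b mod 4 = 2\<close>; the inversions then decide between
      2 and 6 modulo 8.\<close>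
    case True
    have "b mod 4 = 2"
    proof -
      have "(a mod 4) * (b mod 4) mod 4 = 2" using area by (simp add: mod_mult_eq)
      moreover have "a mod 4 = 1 \<or> a mod 4 = 3" using True by presburger
      moreover have "b mod 4 = 0 \<or> b mod 4 = 1 \<or> b mod 4 = 2 \<or> b mod 4 = 3" by presburger
      ultimately show ?thesis by auto
    qed
    define m where "m = nat (b div 4)"
    have b: "b = 4 * int m + 2" using \<open>b mod 4 = 2\<close> assms(2) by (simp add: m_def) presburger
    have "[a * b = 2] (mod 8)"
    proof (cases "a mod 4 = 1")
      case True
      define k where "k = a div 4"
      have a: "a = 4 * k + 1" using True by (simp add: k_def) presburger
      then have "even m" using tiles_M_1_mod_4[of k m] t b assms(1) by simp
      then obtain l where "m = 2 * l" by blast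
      then have "a * b - 2 = 8 * (4 * k * int l + int l + k)" by (simp add: a b algebra_simps)
      then show ?thesis by (simp add: cong_iff_dvd_diff)
    next
      case False
      define k where "k = a div 4"
      have a: "a = 4 * k + 3" using False True by (simp add: k_def) presburger
      then have "odd m" using tiles_M_3_mod_4[of k m] t b assms(1) by simp
      then obtain l where "m = 2 * l + 1" by (auto elim: oddE)
      then have "a * b - 2 = 8 * (4 * k * int l + 3 * int l + 3 * k + 2)" by (simp add: a b algebra_simps)
      then show ?thesis by (simp add: cong_iff_dvd_diff)
    qed
    then show ?thesis using True by simp
  qed
next
  assume c: "([a = 2] (mod 4) \<and> odd b) \<or> (odd a \<and> [a * b = 2] (mod 8))"
  \<comment> \<open>As odd squares are 1 modulo 8, the second alternative amounts to
    \<open>b\<close> being congruent to \<open>2 * a\<close> modulo 8.\<close>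
  have cases: "a mod 4 = 2 \<and> b mod 2 = 1 \<or> a mod 4 = 1 \<and> b mod 8 = 2 \<or> a mod 4 = 3 \<and> b mod 8 = 6"
    using c
  proof
    assume "odd a \<and> [a * b = 2] (mod 8)"
    then have "(a mod 8) * (b mod 8) mod 8 = 2" "odd a" by (auto simp: cong_def mod_mult_eq)
    moreover have "a mod 8 \<in> {1, 3, 5, 7}" using \<open>odd a\<close> by simp presburger
    moreover have "b mod 8 \<in> {0, 1, 2, 3, 4, 5, 6, 7}" by simp presburger
    ultimately have "a mod 8 \<in> {1, 5} \<and> b mod 8 = 2 \<or> a mod 8 \<in> {3, 7} \<and> b mod 8 = 6" by auto
    then show ?thesis by simp presburger
  qed (auto simp: cong_def odd_iff_mod_2_eq_one)
  then show "tiles S (M a b)"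
  proof (elim disjE conjE)
    assume *: "a mod 4 = 2" "b mod 2 = 1"
    define k l where "k = nat (a div 4)" and "l = nat (b div 2)"
    have "a = int (4 * k + 1) + 1" "b = int (2 * l) + 1" using * assms by (simp_all add: k_def l_def) presburger+
    moreover have "2 * l \<ge> 1" using calculation assms by simp
    ultimately show ?thesis using tiles_M_sufficient[OF _ _ steps_2_mod_4[of k l]] by simp
  next
    assume *: "a mod 4 = 1" "b mod 8 = 2"
    \<comment> \<open>Here \<open>a \<ge> 5\<close>, and one block \<open>U^4\<close> is counted
      separately in \<open>Suc k\<close>, hence the \<open>- 1\<close>.\<close>
    define k l where "k = nat (a div 4 - 1)" and "l = nat (b div 8)"
    have "a = int (4 * Suc k) + 1" "b = int (8 * l + 1) + 1" using * assms by (simp_all add: k_def l_def) presburger+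
    then show ?thesis using tiles_M_sufficient[OF _ _ steps_1_mod_4[of k l]] by simp
  next
    assume *: "a mod 4 = 3" "b mod 8 = 6"
    define k l where "k = nat (a div 4)" and "l = nat (b div 8)"
    have "a = int (4 * k + 2) + 1" "b = int (8 * l + 5) + 1" using * assms by (simp_all add: k_def l_def) presburger+
    then show ?thesis using tiles_M_sufficient[OF _ _ steps_3_mod_4[of k l]] by simp
  qed
qed

end
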